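(* Let $A\in\mathbb{R}^{M\times N}$, $y\in\mathbb{R}^M$, $\sigma_{\mathrm{rp}},\sigma_{\mathrm{link}}:\mathbb{R}\to\mathbb{R}$ (acting entry-wise on vectors) and $L:\mathbb{R}^M\times\mathbb{R}^M\to\mathbb{R}$ satisfy (A1)–(A4) (listed in the context), and set $$\mathcal{L}(z)=L\big(\sigma_{\mathrm{link}}(A\sigma_{\mathrm{rp}}(z)),y\big),\qquad \widetilde{\mathcal{L}}(\widetilde z)=L\big(\sigma_{\mathrm{link}}(A\widetilde z),y\big)\qquad(z,\widetilde z\in\mathbb{R}^N).$$ Let $T\in\mathbb{R}_{>0}\cup\{+\infty\}$ and let $w:[0,T)\to\mathbb{R}^N$ be any regular solution of $w'(t)=-\nabla\mathcal{L}(w(t))$, $w(0)=w_0$, with $w_0\in\mathbb{R}^N$. Put $\widetilde w(t)=\sigma_{\mathrm{rp}}(w(t))$ and $\widetilde w_0=\sigma_{\mathrm{rp}}(w_0)$. Let $h:\mathcal{D}_{\mathrm{rp}}\to\mathbb{R}$ be a continuous antiderivative of $$h'(\widetilde z):=\big([\sigma_{\mathrm{rp}}^{-1}]'(\widetilde z)\big)^2,$$ and let $H:\mathcal{D}_{\mathrm{rp}}\to\mathbb{R}$ be a continuous antiderivative of $h$. Suppose that the limit $w_T:=\lim_{t\to T}w(t)$ exists and satisfies $\mathcal{L}(w_T)=0$, let $\widetilde w_T:=\sigma_{\mathrm{rp}}(w_T)$, and suppose that at least one of the following two conditions holds: - $\widetilde w_T\in\mathcal{D}_{\mathrm{rp}}^N$,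 or - the continuous extensions of $h$ and $H$ to $\overline{\mathcal{D}_{\mathrm{rp}}}$ are well-defined and finite-valued. Then $$\widetilde w_T\in\operatorname*{arg\,min}_{\widetilde z\in\overline{\mathcal{D}_{\mathrm{rp}}^N},\ \widetilde{\mathcal{L}}(\widetilde z)=0}\ \langle\mathbf 1,\,H(\widetilde z)-\widetilde z\odot h(\widetilde w_0)\rangle .$$ Moreover, let $D_F(\widetilde z,\widetilde w_0)$ denote the Bregman divergence on $\mathcal{D}_{\mathrm{rp}}^N$ with respect to $F(\widetilde z):=\langle\mathbf 1,H(\widetilde z)\rangle$, extended in $\widetilde z$ to $\overline{\mathcal{D}_{\mathrm{rp}}^N}$ by continuity (with $+\infty$ as an admissible value). Then minimizing the objective $\widetilde z\mapsto\langle\mathbf 1,\,H(\widetilde z)-\widetilde z\odot h(\widetilde w_0)\rangle$ is equivalent to minimizing $D_F(\cdot,\widetilde w_0)$, in the sense that the set of global minimizers over $\{\widetilde z\in\overline{\mathcal{D}_{\mathrm{rp}}^N}:\widetilde{\mathcal{L}}(\widetilde z)=0\}$ is the same.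
   Context: Scalar functions act entry-wise on vectors; $\odot$ is the entry-wise product; $\mathbf 1$ is the all-ones vector. Assumptions: (A1) $\sigma_{\mathrm{link}}:\mathbb{R}\to\mathbb{R}$ is continuously differentiable and injective, and $y\in\sigma_{\mathrm{link}}(\mathbb{R}^M)$. (A2) There is an interval $\mathcal{D}_{\mathrm{rp}}\subset\mathbb{R}$ such that $\sigma_{\mathrm{rp}}:\mathbb{R}\to\mathcal{D}_{\mathrm{rp}}$ is invertible and continuously differentiable, and $\sigma_{\mathrm{rp}}'(x)\neq0$ almost everywhere. Furthermore $([\sigma_{\mathrm{rp}}^{-1}]')^2\in L_1^c(\mathcal{D}_{\mathrm{rp}})=\{f: f|_C\in L_1(C)\text{ for every compact }C\subset\mathcal{D}_{\mathrm{rp}}\}$, where $([\sigma_{\mathrm{rp}}^{-1}]')^2$ is defined almost everywhere on $\mathcal{D}_{\mathrm{rp}}$. (A3) $L$ is continuously differentiable, convex in the first argument, $\min L=0$, and $L(z,z')=\min L$ if and only if $z=z'$. (A4) There exists $\widetilde z_0\in\mathcal{D}_{\mathrm{rp}}^N$ with $\sigma_{\mathrm{link}}(A\widetilde z_0)=y$. A solution $w$ of the gradient flow (solutions need not be unique) is regular if $\{t\in[0,T):\sigma_{\mathrm{rp}}'(w(t)_i)=0\text{ for some }i\in\{1,\dots,N\}\}$ is finite. A continuous antiderivative of the locally integrable function $h'$ means $h(b)-h(a)=\int_a^b h'(s)\,ds$ for $a,b\in\mathcal{D}_{\mathrm{rp}}$. $H$ (and hence the objective) is extended to the closure by continuity,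 with value $+\infty$ allowed. Bregman divergence: for a continuously differentiable strictly convex $F$, $D_F(p,q)=F(p)-F(q)-\langle\nabla F(q),p-q\rangle$. $D_F$ does not depend on the choice of the antiderivatives $h,H$. *)

theory Defs
  imports "HOL-Analysis.Analysis"
begin

definition entrywise :: "('a \<Rightarrow> 'b) \<Rightarrow> 'a ^ 'n \<Rightarrow> 'b ^ 'n"
  where "entrywise f x = (\<chi> i. f (x $ i))"

definition cart_power :: "'a set \<Rightarrow> ('a ^ 'n) set"
  where "cart_power D = {x. \<forall>i. x $ i \<in> D}"

definition continuously_differentiable ::
    "('a::real_normed_vector \<Rightarrow> 'b::real_normed_vector) \<Rightarrow> bool"
  where "continuously_differentiable f \<longleftrightarrow>
    (\<exists>f'. (\<forall>x. (f has_derivative blinfun_apply (f' x)) (at x)) \<and> continuous_on UNIV f')"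

definition gradient :: "('a::real_inner \<Rightarrow> real) \<Rightarrow> 'a \<Rightarrow> 'a"
  where "gradient f x = (THE D. GDERIV f x :> D)"

text \<open>
  The inverse derivative is defined only almost everywhere; \<open>deriv\<close> takes unspecified values on
  the exceptional null set, to which Lebesgue integrals are insensitive.
\<close>

definition inv_deriv_sq :: "(real \<Rightarrow> real) \<Rightarrow> real \<Rightarrow> real"
  where "inv_deriv_sq \<sigma> z = (deriv (inv \<sigma>) z)\<^sup>2"

definition locally_L1_on :: "(real \<Rightarrow> real) \<Rightarrow> real set \<Rightarrow> bool"
  where "locally_L1_on f D \<longleftrightarrow> (\<forall>C. compact C \<and> C \<subseteq> D \<longrightarrow> set_integrable lebesgue C f)"

definition continuous_antiderivative_on ::
    "real set \<Rightarrow> (real \<Rightarrow> real) \<Rightarrow> (real \<Rightarrow> real) \<Rightarrow> bool"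
  where "continuous_antiderivative_on D f g \<longleftrightarrow>
    continuous_on D g \<and>
    (\<forall>a\<in>D. \<forall>b\<in>D. a \<le> b \<longrightarrow> (f has_integral (g b - g a)) {a..b})"

text \<open>
  Extension by continuity with infinite values allowed. For the antiderivative \<open>H\<close> on an open
  interval, the limits at finite end points exist in \<open>(-\<infinity>, \<infinity>]\<close> because \<open>H\<close> is convex.
\<close>

definition cont_ext :: "'a::t2_space set \<Rightarrow> ('a \<Rightarrow> real) \<Rightarrow> 'a \<Rightarrow> ereal"
  where "cont_ext S f x =
    (if x \<in> S then ereal (f x) else Lim (at x within S) (\<lambda>u. ereal (f u)))"

definition has_finite_cont_ext :: "'a::t2_space set \<Rightarrow> ('a \<Rightarrow> real) \<Rightarrow> bool"
  where "has_finite_cont_ext S f \<longleftrightarrow>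
    (\<exists>g::'a \<Rightarrow> real. continuous_on (closure S) g \<and> (\<forall>x\<in>S. g x = f x))"

text \<open>
  The extension of a function on the reals to the end points \<open>\<plusminus>\<infinity>\<close> by its limits there;
  it agrees with \<open>f\<close> at finite arguments. The limit of the flow may have infinite components:
  since \<open>\<sigma>\<close> maps onto \<open>D\<close>, only these can be mapped to boundary points of \<open>D\<close>.
\<close>

definition ext_real :: "(real \<Rightarrow> real) \<Rightarrow> ereal \<Rightarrow> ereal"
  where "ext_real f = cont_ext (range ereal) (\<lambda>u. f (real_of_ereal u))"

definition reduced_loss ::
    "((real ^ 'm) \<times> (real ^ 'm) \<Rightarrow> real) \<Rightarrow> (real \<Rightarrow> real) \<Rightarrow> real ^ 'n ^ 'm \<Rightarrow> real ^ 'm \<Rightarrow>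
      real ^ 'n \<Rightarrow> real"
  where "reduced_loss L \<sigma>link A y z = L (entrywise \<sigma>link (A *v z), y)"

definition param_loss ::
    "((real ^ 'm) \<times> (real ^ 'm) \<Rightarrow> real) \<Rightarrow> (real \<Rightarrow> real) \<Rightarrow> (real \<Rightarrow> real) \<Rightarrow>
      real ^ 'n ^ 'm \<Rightarrow> real ^ 'm \<Rightarrow> real ^ 'n \<Rightarrow> real"
  where "param_loss L \<sigma>link \<sigma>rp A y z = L (entrywise \<sigma>link (A *v entrywise \<sigma>rp z), y)"

definition time_interval :: "ereal \<Rightarrow> real set"
  where "time_interval T = {t. 0 \<le> t \<and> ereal t < T}"

definition gradient_flow ::
    "('a::real_inner \<Rightarrow> real) \<Rightarrow> ereal \<Rightarrow> 'a \<Rightarrow> (real \<Rightarrow> 'a) \<Rightarrow> bool"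
  where "gradient_flow f T w0 w \<longleftrightarrow>
    w 0 = w0 \<and>
    (\<forall>t\<in>time_interval T.
      (w has_vector_derivative - gradient f (w t)) (at t within time_interval T))"

definition regular_curve :: "(real \<Rightarrow> real) \<Rightarrow> ereal \<Rightarrow> (real \<Rightarrow> real ^ 'n) \<Rightarrow> bool"
  where "regular_curve \<sigma> T w \<longleftrightarrow>
    finite {t \<in> time_interval T. \<exists>i. deriv \<sigma> (w t $ i) = 0}"

definition separable_sum :: "(real \<Rightarrow> real) \<Rightarrow> real ^ 'n \<Rightarrow> real"
  where "separable_sum H z = (\<Sum>i\<in>UNIV. H (z $ i))"

text \<open>
  The objective \<open>\<langle>\<one>, H z - z \<odot> h v\<rangle>\<close> with \<open>H\<close> extended by continuity to the closure of \<open>D\<close>. No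
  summand is \<open>-\<infinity>\<close>, so the sum of extended reals is unambiguous.
\<close>

definition objective ::
    "real set \<Rightarrow> (real \<Rightarrow> real) \<Rightarrow> (real \<Rightarrow> real) \<Rightarrow> real ^ 'n \<Rightarrow> real ^ 'n \<Rightarrow> ereal"
  where "objective D h H v z =
    (\<Sum>i\<in>UNIV. cont_ext D H (z $ i) - ereal (z $ i * h (v $ i)))"

definition bregman_div :: "('a::real_inner \<Rightarrow> real) \<Rightarrow> 'a \<Rightarrow> 'a \<Rightarrow> real"
  where "bregman_div F p q = F p - F q - gradient F q \<bullet> (p - q)"

end

theory Submission
  imports Defs
begin

text \<open>
  Why the theorem holds. By the chain rule every component of the gradient of the loss in the
  variable \<open>w\<close> has the form \<open>\<sigma>rp'(w\<^sub>i) (A\<^sup>T r)\<^sub>i\<close> for some vector \<open>r\<close> depending on \<open>w\<close>. Since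
  \<open>h' = (1 / \<sigma>rp')\<^sup>2\<close> at \<open>\<sigma>rp(w\<^sub>i)\<close>, the two factors \<open>\<sigma>rp'\<close> (one from the gradient, one from
  differentiating \<open>\<sigma>rp(w\<^sub>i)\<close>) cancel, and \<open>h(\<sigma>rp(w(t)))\<close> moves with velocity \<open>- A\<^sup>T r\<close>:
  the flow is a mirror flow. Consequently \<open>h(\<sigma>rp(w(t))) - h(\<sigma>rp(w0))\<close> stays orthogonal to the kernel
  of \<open>A\<close> (\<open>mirror_flow_conserved\<close>); continuity of this quantity bridges the finitely many times at
  which some \<open>\<sigma>rp'(w\<^sub>i)\<close> vanishes and the cancellation breaks down.

  Zero loss and injectivity of \<open>\<sigma>link\<close> force all feasible points to have the same image under \<open>A\<close>, so
  that any two of them differ by an element of this kernel. The antiderivative \<open>H\<close> is convex, because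
  \<open>h\<close> is nondecreasing; its supporting line at a point of the trajectory, in the form that reaches
  up to the closure of \<open>D\<close> (\<open>extended_supporting_line\<close>), bounds the objective at a feasible point
  \<open>u\<close> from below. By the conservation law this bound does not depend on \<open>u\<close>, and as time tends to \<open>T\<close> it
  converges to the objective at the limit point. Working along the trajectory, rather than at the
  limit itself, treats limits inside \<open>D\<close> and on its boundary by the same argument: all that is used is
  that \<open>h\<close> and \<open>H\<close> have finite limits along the trajectory.

  For the second claim, the Bregman divergence differs from the objective by a constant on the power
  of \<open>D\<close>, and this persists for the continuous extensions (\<open>bregman_ext_eq_objective\<close>). The only
  subtlety is that the extension of a sum is the sum of the extensions: the boundary limits of \<open>H\<close>
  exist by convexity and are never \<open>-\<infinity>\<close>, so infinities of opposite sign never meet in a sum.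
\<close>

section \<open>Gradients and antiderivatives\<close>

lemma gradient_eqI:
  assumes "GDERIV f x :> g"
  shows "gradient f x = g"
  unfolding gradient_def
proof (rule the_equality)
  show "GDERIV f x :> g" by (fact assms)
  fix g' assume "GDERIV f x :> g'"
  with assms have "(\<lambda>k. k \<bullet> g') = (\<lambda>k. k \<bullet> g)"
    unfolding gderiv_def by (rule has_derivative_unique[rotated])
  then show "g' = g"
    by (metis vector_eq_ldot)
qed

lemma C1_has_real_derivative:
  fixes f :: "real \<Rightarrow> real"
  assumes "f C1_differentiable_on UNIV"
  shows "(f has_real_derivative deriv f x) (at x)"
    and "continuous_on UNIV (deriv f)" and "continuous_on UNIV f"
proof -
  from assms obtain f' where f': "\<And>x. (f has_real_derivative f' x) (at x)" "continuous_on UNIV f'"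
    unfolding C1_differentiable_on_def has_real_derivative_iff_has_vector_derivative by auto
  moreover from f'(1) have "deriv f = f'"
    by (auto intro: DERIV_imp_deriv)
  ultimately show "(f has_real_derivative deriv f x) (at x)" and "continuous_on UNIV (deriv f)"
    by auto
  from f'(1) show "continuous_on UNIV f"
    by (meson DERIV_isCont continuous_at_imp_continuous_on)
qed

lemma has_derivative_entrywise:
  fixes z :: "real ^ 'n"
  assumes "\<And>i. (f has_real_derivative f' (z $ i)) (at (z $ i))"
  shows "(entrywise f has_derivative (\<lambda>v. \<chi> i. f' (z $ i) * v $ i)) (at z)"
proof -
  have "((\<lambda>z. f (z $ i)) has_derivative (\<lambda>v. f' (z $ i) * v $ i)) (at z)" for i
    using has_derivative_compose[OF bounded_linear_imp_has_derivative[OF bounded_linear_vec_nth]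
        assms[unfolded has_field_derivative_def]] .
  then show ?thesis
    by (subst has_derivative_componentwise_within)
      (auto simp: Basis_vec_def entrywise_def inner_axis)
qed

lemma gradient_separable_sum:
  fixes v :: "real ^ 'n"
  assumes "\<And>i. (H has_real_derivative h (v $ i)) (at (v $ i))"
  shows "gradient (separable_sum H) v = entrywise h v"
proof (rule gradient_eqI)
  have "((\<lambda>z. H (z $ i)) has_derivative (\<lambda>k. h (v $ i) * k $ i)) (at v)" for i
    using has_derivative_compose[OF bounded_linear_imp_has_derivative[OF bounded_linear_vec_nth]
        assms[unfolded has_field_derivative_def]] .
  then have "((\<lambda>z. \<Sum>i\<in>UNIV. H (z $ i)) has_derivative (\<lambda>k. \<Sum>i\<in>UNIV. h (v $ i) * k $ i)) (at v)"
    by (intro has_derivative_sum)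
  then show "GDERIV (separable_sum H) v :> entrywise h v"
    by (simp add: gderiv_def separable_sum_def[abs_def] inner_vec_def entrywise_def mult.commute)
qed

lemma antiderivative_has_derivative:
  assumes "open D" and g: "continuous_antiderivative_on D f g" and z: "z \<in> D" "isCont f z"
  shows "(g has_real_derivative f z) (at z)"
proof -
  obtain e where e: "0 < e" "cball z e \<subseteq> D"
    using \<open>open D\<close> z(1) open_contains_cball by blast
  define a b where "a = z - e" and "b = z + e"
  have ab: "{a..b} \<subseteq> D" "a \<in> D" "b \<in> D" "a < z" "z < b"
    using e by (auto simp: a_def b_def cball_def dist_real_def subset_iff)
  have int: "(f has_integral (g v - g u)) {u..v}" if "u \<in> D" "v \<in> D" "u \<le> v" for u v
    using g that by (auto simp: continuous_antiderivative_on_def)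
  have "((\<lambda>u. integral {a..u} f) has_vector_derivative f z) (at z within {a..b} - {})"
    using ab int[of a b] z(2)
    by (intro integral_has_vector_derivative_continuous_at)
      (auto intro: continuous_at_imp_continuous_within)
  moreover have "at z within {a..b} - {} = at z"
    using ab by (simp add: at_within_Icc_at)
  ultimately have "((\<lambda>u. g a + integral {a..u} f) has_real_derivative f z) (at z)"
    by (auto simp: has_real_derivative_iff_has_vector_derivative intro!: derivative_eq_intros)
  moreover have "g a + integral {a..u} f = g u" if "u \<in> {a<..<b}" for u
    using integral_unique[OF int[of a u]] that ab(1,2) by (auto simp: subset_iff)
  ultimately show ?thesis
    using ab by - (erule has_field_derivative_transform_within_open[where S = "{a<..<b}"], simp_all)
qed

text \<open>
  Only the factor \<open>deriv \<sigma>rp (z $ i)\<close> depends on \<open>i\<close> other than through the \<open>i\<close>-th column of \<open>A\<close>: by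
  the chain rule \<open>G\<close> is the derivative of the loss with respect to \<open>A \<sigma>rp(z)\<close>. Linearity of \<open>G\<close> is
  what later turns a vanishing combination of columns into a vanishing combination of gradient
  components.
\<close>

lemma gradient_param_loss_factorisation:
  fixes A :: "real ^ 'n ^ 'm"
  assumes "\<sigma>link C1_differentiable_on UNIV" "\<sigma>rp C1_differentiable_on UNIV"
    and "continuously_differentiable L"
  shows "\<exists>G. linear G \<and>
    (\<forall>i. gradient (param_loss L \<sigma>link \<sigma>rp A y) z $ i = deriv \<sigma>rp (z $ i) * G (A *v axis i 1))"
proof -
  define x where "x = A *v entrywise \<sigma>rp z"
  define E where "E u = (\<chi> i. deriv \<sigma>link (x $ i) * u $ i)" for u :: "real ^ 'm"
  define R where "R v = (\<chi> i. deriv \<sigma>rp (z $ i) * v $ i)" for v :: "real ^ 'n"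
  obtain L' where L': "\<And>p. (L has_derivative blinfun_apply (L' p)) (at p)"
    using assms(3) unfolding continuously_differentiable_def by blast
  define G where "G u = L' (entrywise \<sigma>link x, y) (E u, 0)" for u
  have dR: "(entrywise \<sigma>rp has_derivative R) (at z)"
    unfolding R_def by (intro has_derivative_entrywise C1_has_real_derivative(1) assms)
  have dE: "(entrywise \<sigma>link has_derivative E) (at x)"
    unfolding E_def by (intro has_derivative_entrywise C1_has_real_derivative(1) assms)
  have lin_E: "linear E"
    using dE by (rule has_derivative_linear)
  have lin: "linear G"
    unfolding G_def using lin_E
    by (intro linearI) (simp_all add: linear_add linear_scale
        flip: blinfun.add_right blinfun.scaleR_right real_scaleR_def)
  have "((\<lambda>z. A *v entrywise \<sigma>rp z) has_derivative (\<lambda>v. A *v R v)) (at z)"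
    using dR by (rule bounded_linear.has_derivative[OF matrix_vector_mul_bounded_linear])
  from has_derivative_compose[OF this, folded x_def, OF dE]
  have "((\<lambda>z. (entrywise \<sigma>link (A *v entrywise \<sigma>rp z), y)) has_derivative
      (\<lambda>v. (E (A *v R v), 0))) (at z)"
    by (intro has_derivative_Pair has_derivative_const)
  from has_derivative_compose[OF this L']
  have dloss: "(param_loss L \<sigma>link \<sigma>rp A y has_derivative (\<lambda>v. G (A *v R v))) (at z)"
    by (simp add: param_loss_def[abs_def] G_def x_def)
  have linGR: "linear (\<lambda>v. G (A *v R v))"
    using dloss by (rule has_derivative_linear)
  define g where "g = (\<chi> i. G (A *v R (axis i 1)))"
  have "G (A *v R v) = v \<bullet> g" for v
  proof -
    have "G (A *v R v) = (\<Sum>i\<in>UNIV. v $ i * G (A *v R (axis i 1)))"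
      using linear_sum[OF linGR, of "\<lambda>i. v $ i *s axis i 1" UNIV] linear_scale[OF linGR] basis_expansion[of v]
      by (simp add: scalar_mult_eq_scaleR)
    then show ?thesis by (simp add: inner_vec_def g_def)
  qed
  then have "gradient (param_loss L \<sigma>link \<sigma>rp A y) z = g"
    using dloss by (intro gradient_eqI) (simp add: gderiv_def)
  moreover have "R (axis i 1) = deriv \<sigma>rp (z $ i) *\<^sub>R axis i 1" for i
    by (simp add: R_def vec_eq_iff axis_def)
  ultimately have "gradient (param_loss L \<sigma>link \<sigma>rp A y) z $ i = deriv \<sigma>rp (z $ i) * G (A *v axis i 1)" for i
    by (simp add: g_def matrix_vector_mult_scaleR linear_scale[OF lin])
  with lin show ?thesis by blast
qed

text \<open>
  The fundamental theorem of calculus needs continuity of the integrand \<open>((\<sigma>\<^sup>-\<^sup>1)')\<^sup>2\<close> at \<open>\<sigma> x\<close>.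
  Continuity of \<open>\<sigma>'\<close> supplies it: \<open>\<sigma>'\<close> is nonzero near \<open>x\<close>, hence the integrand agrees near
  \<open>\<sigma> x\<close> with the continuous function \<open>(1 / \<sigma>' \<circ> \<sigma>\<^sup>-\<^sup>1)\<^sup>2\<close>.
\<close>

lemma inv_deriv_sq_antiderivative_deriv:
  assumes "open D" "bij_betw \<sigma> UNIV D" "\<sigma> C1_differentiable_on UNIV"
    and h: "continuous_antiderivative_on D (inv_deriv_sq \<sigma>) h"
    and nz: "deriv \<sigma> x \<noteq> 0"
  shows "(h has_real_derivative inverse ((deriv \<sigma> x)\<^sup>2)) (at (\<sigma> x))"
proof -
  have inj: "inj \<sigma>" and ran: "range \<sigma> = D"
    using assms(2) by (auto simp: bij_betw_def)
  note d = C1_has_real_derivative[OF assms(3)]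
  have inv_cont: "isCont (inv \<sigma>) (\<sigma> x)" for x
    using inj DERIV_isCont[OF d(1)] using isCont_inverse_function[of 1 x "inv \<sigma>" \<sigma>] by simp
  have inv_deriv: "inv_deriv_sq \<sigma> (\<sigma> x) = inverse ((deriv \<sigma> x)\<^sup>2)" if "deriv \<sigma> x \<noteq> 0" for x
  proof -
    have "(inv \<sigma> has_real_derivative inverse (deriv \<sigma> x)) (at (\<sigma> x))"
      using that d(1)[of x] inj inv_cont \<open>open D\<close> ran
      by (intro has_field_derivative_inverse_basic[where f = \<sigma> and t = D]) (auto simp: f_inv_into_f)
    then show ?thesis
      by (simp add: inv_deriv_sq_def DERIV_imp_deriv power_inverse)
  qed
  define z where "z = \<sigma> x"
  have "z \<in> D" using ran by (auto simp: z_def)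
  have c\<sigma>': "isCont (deriv \<sigma>) x" using d(2) by (simp add: continuous_on_eq_continuous_at)
  have lim_inv: "((\<lambda>u. deriv \<sigma> (inv \<sigma> u)) \<longlongrightarrow> deriv \<sigma> x) (at z)"
    using isCont_o2[OF inv_cont[of x], of "deriv \<sigma>"] c\<sigma>' inj
    by (simp add: isCont_def z_def)
  have "eventually (\<lambda>u. deriv \<sigma> (inv \<sigma> u) \<noteq> 0) (at z)"
    using tendsto_imp_eventually_ne[OF lim_inv nz] .
  moreover have "eventually (\<lambda>u. u \<in> D) (at z)"
    using \<open>open D\<close> \<open>z \<in> D\<close> by (rule eventually_at_in_open')
  ultimately have "eventually (\<lambda>u. inverse ((deriv \<sigma> (inv \<sigma> u))\<^sup>2) = inv_deriv_sq \<sigma> u) (at z)"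
  proof eventually_elim
    case (elim u)
    then show ?case using inv_deriv[of "inv \<sigma> u"] ran by (simp add: f_inv_into_f)
  qed
  moreover have "((\<lambda>u. inverse ((deriv \<sigma> (inv \<sigma> u))\<^sup>2)) \<longlongrightarrow> inverse ((deriv \<sigma> x)\<^sup>2)) (at z)"
    using nz by (intro tendsto_intros lim_inv) auto
  ultimately have cont: "isCont (inv_deriv_sq \<sigma>) z"
    unfolding isCont_def z_def inv_deriv[OF nz] by (rule Lim_transform_eventually[rotated])
  from antiderivative_has_derivative[OF \<open>open D\<close> h \<open>z \<in> D\<close> cont]
  show ?thesis by (simp add: z_def inv_deriv[OF nz])
qed

section \<open>The conservation law of the mirror flow\<close>

lemma time_interval_Icc:
  assumes "t \<in> time_interval T"
  shows "{0..t} \<subseteq> time_interval T"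
proof
  fix s assume s: "s \<in> {0..t}"
  then have "ereal s \<le> ereal t" by simp
  also have "\<dots> < T" using assms by (simp add: time_interval_def)
  finally show "s \<in> time_interval T" using s by (simp add: time_interval_def)
qed

text \<open>
  The quantity has derivative \<open>- G (A v) = 0\<close>, with the linear map \<open>G\<close> of
  \<open>gradient_param_loss_factorisation\<close>, wherever no \<open>\<sigma>rp'(w\<^sub>i)\<close> vanishes. It is continuous, and a
  continuous function whose derivative vanishes off a finite set is constant.
\<close>

lemma mirror_flow_conserved:
  fixes A :: "real ^ 'n ^ 'm" and w :: "real \<Rightarrow> real ^ 'n"
  assumes "\<sigma>link C1_differentiable_on UNIV" "continuously_differentiable L"
    and \<sigma>: "\<sigma>rp C1_differentiable_on UNIV" "bij_betw \<sigma>rp UNIV D" and "open D"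
    and flow: "gradient_flow (param_loss L \<sigma>link \<sigma>rp A y) T w0 w"
    and regular: "regular_curve \<sigma>rp T w"
    and h: "continuous_antiderivative_on D (inv_deriv_sq \<sigma>rp) h"
    and v: "A *v v = 0" and t: "t \<in> time_interval T"
  shows "(\<Sum>i\<in>UNIV. v $ i * h (\<sigma>rp (w t $ i))) = (\<Sum>i\<in>UNIV. v $ i * h (\<sigma>rp (w0 $ i)))"
proof -
  let ?loss = "param_loss L \<sigma>link \<sigma>rp A y"
  define K where "K = {t \<in> time_interval T. \<exists>i. deriv \<sigma>rp (w t $ i) = 0}"
  define \<phi> where "\<phi> s = (\<Sum>i\<in>UNIV. v $ i * h (\<sigma>rp (w s $ i)))" for s
  note sub = time_interval_Icc[OF t]
  note d\<sigma> = C1_has_real_derivative[OF \<sigma>(1)]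
  have "0 \<le> t" using t by (simp add: time_interval_def)
  have dw: "(w has_vector_derivative - gradient ?loss (w s)) (at s within {0..t})" if "s \<in> {0..t}" for s
    using flow sub that unfolding gradient_flow_def
    by (blast intro: has_vector_derivative_within_subset)
  then have cw: "continuous_on {0..t} w"
    unfolding continuous_on_eq_continuous_within by (blast intro: has_vector_derivative_continuous)
  have "continuous_on {0..t} (\<lambda>s. h (\<sigma>rp (w s $ i)))" for i
  proof (rule continuous_on_compose2[of D h])
    show "continuous_on D h" using h by (simp add: continuous_antiderivative_on_def)
    show "continuous_on {0..t} (\<lambda>s. \<sigma>rp (w s $ i))"
      by (rule continuous_on_compose2[OF d\<sigma>(3)]) (auto intro!: continuous_intros cw)
    show "(\<lambda>s. \<sigma>rp (w s $ i)) ` {0..t} \<subseteq> D"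
      using \<sigma>(2) by (auto simp: bij_betw_def)
  qed
  then have c\<phi>: "continuous_on {0..t} \<phi>"
    unfolding \<phi>_def by (intro continuous_intros)
  have d\<phi>: "(\<phi> has_derivative (\<lambda>_. 0)) (at s within {0..t})" if s: "s \<in> {0..t} - K" for s
  proof -
    have nz: "deriv \<sigma>rp (w s $ i) \<noteq> 0" for i
      using s sub by (auto simp: K_def)
    obtain G where G: "linear G"
      "\<And>i. gradient ?loss (w s) $ i = deriv \<sigma>rp (w s $ i) * G (A *v axis i 1)"
      using gradient_param_loss_factorisation[OF assms(1) \<sigma>(1) assms(2)] by blast
    have "((\<lambda>s. h (\<sigma>rp (w s $ i))) has_real_derivative - G (A *v axis i 1)) (at s within {0..t})" for i
    proof -
      have "((\<lambda>s. w s $ i) has_real_derivative - gradient ?loss (w s) $ i) (at s within {0..t})"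
        using bounded_linear.has_vector_derivative[OF bounded_linear_vec_nth dw] s
        by (simp add: has_real_derivative_iff_has_vector_derivative)
      \<comment> \<open>The product \<open>(1 / \<sigma>rp')\<^sup>2 \<cdot> \<sigma>rp' \<cdot> (- \<sigma>rp' G(A e\<^sub>i))\<close>, in which \<open>\<sigma>rp'\<close> cancels.\<close>
      from DERIV_chain2[OF inv_deriv_sq_antiderivative_deriv[OF \<open>open D\<close> \<sigma>(2,1) h nz]
          DERIV_chain2[OF d\<sigma>(1) this]]
      show ?thesis
        using nz[of i] by (simp add: G(2) power2_eq_square field_simps)
    qed
    then have "(\<phi> has_real_derivative (\<Sum>i\<in>UNIV. v $ i * - G (A *v axis i 1))) (at s within {0..t})"
      unfolding \<phi>_def by (intro DERIV_sum DERIV_cmult)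
    moreover have "(\<Sum>i\<in>UNIV. v $ i * - G (A *v axis i 1)) = 0"
    proof -
      have "A *v v = (\<Sum>i\<in>UNIV. v $ i *\<^sub>R (A *v axis i 1))"
        using basis_expansion[of v] linear_sum[OF matrix_vector_mul_linear[of A], of "\<lambda>i. v $ i *s axis i 1" UNIV]
        by (simp add: scalar_mult_eq_scaleR matrix_vector_mult_scaleR)
      then have "G (A *v v) = (\<Sum>i\<in>UNIV. v $ i * G (A *v axis i 1))"
        by (simp add: linear_sum[OF G(1)] linear_scale[OF G(1)])
      with v linear_0[OF G(1)] show ?thesis by (simp add: sum_negf)
    qed
    ultimately have "(\<phi> has_real_derivative 0) (at s within {0..t})" by simp
    then show ?thesis by (simp add: has_field_derivative_def lambda_zero)
  qed
  have "\<phi> t = \<phi> 0"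
    by (rule has_derivative_zero_unique_strong_interval[OF _ c\<phi> refl d\<phi>])
      (use regular \<open>0 \<le> t\<close> in \<open>auto simp: K_def regular_curve_def\<close>)
  moreover have "w 0 = w0" using flow by (simp add: gradient_flow_def)
  ultimately show ?thesis by (simp add: \<phi>_def)
qed

section \<open>Extension by continuity\<close>

lemma tendsto_SUP_of_eventually_le:
  fixes f :: "'a \<Rightarrow> 'b::{complete_linorder, linorder_topology}"
  assumes "\<forall>\<^sub>F v in F. v \<in> S" and "\<And>u. u \<in> S \<Longrightarrow> \<forall>\<^sub>F v in F. f u \<le> f v"
  shows "(f \<longlongrightarrow> (SUP u\<in>S. f u)) F"
proof (rule increasing_tendsto)
  show "\<forall>\<^sub>F v in F. f v \<le> (SUP u\<in>S. f u)"
    using assms(1) by eventually_elim (rule SUP_upper)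
next
  fix b assume "b < (SUP u\<in>S. f u)"
  then obtain u where "u \<in> S" "b < f u" by (auto simp: less_SUP_iff)
  show "\<forall>\<^sub>F v in F. b < f v"
    using assms(2)[OF \<open>u \<in> S\<close>] by eventually_elim (use \<open>b < f u\<close> in order)
qed

text \<open>
  The filter \<open>inf (nhds x) (principal S)\<close> describes approaching \<open>x\<close> inside \<open>S\<close>, with \<open>x\<close> itself
  admitted, as opposed to \<open>at x within S\<close>. The limit is stated for it because a trajectory, or one
  component of a vector that tends to \<open>p\<close>, may attain its limit.
\<close>

lemma tendsto_cont_ext:
  fixes f :: "'a::t2_space \<Rightarrow> real"
  assumes "x \<in> S \<Longrightarrow> continuous (at x within S) f"
    and "x \<notin> S \<Longrightarrow> ((\<lambda>u. ereal (f u)) \<longlongrightarrow> l) (at x within S)"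
  shows "((\<lambda>u. ereal (f u)) \<longlongrightarrow> cont_ext S f x) (inf (nhds x) (principal S))"
proof (cases "x \<in> S")
  case True
  then have "((\<lambda>u. ereal (f u)) \<longlongrightarrow> ereal (f x)) (at x within S)"
    using assms(1) by (simp add: continuous_within)
  with True show ?thesis
    by (simp add: cont_ext_def tendsto_at_within_iff_tendsto_nhds)
next
  case False
  then have F: "inf (nhds x) (principal S) = at x within S"
    by (simp add: at_within_def)
  with assms(2)[OF False] False show ?thesis
    by (cases "at x within S = bot") (auto simp: cont_ext_def tendsto_Lim)
qed

lemma nhds_inf_principal_neq_bot:
  assumes "x \<in> closure S"
  shows "inf (nhds x) (principal S) \<noteq> bot"
proof
  assume "inf (nhds x) (principal S) = bot"
  then have "\<forall>\<^sub>F u in nhds x. u \<notin> S"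
    by (simp add: trivial_limit_def eventually_inf_principal)
  then obtain U where "open U" "x \<in> U" "\<And>u. u \<in> U \<Longrightarrow> u \<notin> S"
    by (auto simp: eventually_nhds)
  with assms show False
    by (auto simp: closure_iff_nhds_not_empty)
qed

lemma cont_ext_eqI:
  fixes f :: "'a::t2_space \<Rightarrow> real"
  assumes "x \<in> closure S" and l: "((\<lambda>u. ereal (f u)) \<longlongrightarrow> l) (inf (nhds x) (principal S))"
  shows "cont_ext S f x = l"
proof (cases "x \<in> S")
  case True
  \<comment> \<open>The approach includes the constant path at \<open>x\<close>, so the limit must be the value there.\<close>
  have "((\<lambda>u. ereal (f u)) \<longlongrightarrow> l) (principal {x})"
    using True by (intro tendsto_mono[OF _ l])
      (auto simp: le_principal eventually_nhds_x_imp_x intro!: inf_greatest filter_leI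
        simp: eventually_principal)
  moreover have "((\<lambda>u. ereal (f u)) \<longlongrightarrow> ereal (f x)) (principal {x})"
    by (auto simp: tendsto_def eventually_principal)
  ultimately have "l = ereal (f x)"
    by (rule tendsto_unique[rotated]) (simp add: principal_eq_bot_iff)
  with True show ?thesis by (simp add: cont_ext_def)
next
  case False
  then have F: "inf (nhds x) (principal S) = at x within S"
    by (simp add: at_within_def)
  with nhds_inf_principal_neq_bot[OF assms(1)] l False show ?thesis
    by (auto simp: cont_ext_def tendsto_Lim)
qed

text \<open>
  At a finite limit this is continuity of \<open>\<sigma>\<close>. At \<open>\<plusminus>\<infinity>\<close> the value of \<open>ext_real \<sigma>\<close> is a genuine limit
  because a continuous injective function on the reals is monotone; the decreasing case reduces to
  the increasing one by negation.
\<close>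

lemma ext_real_tendsto:
  fixes \<sigma> :: "real \<Rightarrow> real"
  assumes cont: "continuous_on UNIV \<sigma>" and "inj \<sigma>" and lim: "((\<lambda>t. ereal (f t)) \<longlongrightarrow> a) F"
  shows "((\<lambda>t. ereal (\<sigma> (f t))) \<longlongrightarrow> ext_real \<sigma> a) F"
proof -
  let ?\<sigma> = "\<lambda>u. \<sigma> (real_of_ereal u)"
  let ?F = "at a within range ereal"
  have dom: "\<forall>\<^sub>F u in ?F. u \<in> range ereal" if "a \<notin> range ereal"
    using that by (simp add: eventually_at_topological) (metis open_UNIV UNIV_I)
  have mono: "\<exists>l. ((\<lambda>u. ereal (g (real_of_ereal u))) \<longlongrightarrow> l) ?F"
    if a: "a \<notin> range ereal" and g: "mono g \<or> antimono g" for g :: "real \<Rightarrow> real"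
  proof -
    have "a = \<infinity> \<or> a = -\<infinity>" using a by (cases a) auto
    moreover have ev: "\<forall>\<^sub>F v in ?F. (if a = \<infinity> then u < v else v < u)" if "u \<in> range ereal" for u
      using that a \<open>a = \<infinity> \<or> a = -\<infinity>\<close>
      by (auto intro!: order_tendstoD[OF tendsto_ident_at])
    \<comment> \<open>The order in which \<open>a\<close> is the last point.\<close>
    define before where "before r s \<longleftrightarrow> (if a = \<infinity> then r \<le> s else s \<le> r)" for r s :: real
    have inc: "\<exists>l. ((\<lambda>u. ereal (g (real_of_ereal u))) \<longlongrightarrow> l) ?F"
      if "\<And>r s. before r s \<Longrightarrow> g r \<le> g s" for g
    proof (rule exI, rule tendsto_SUP_of_eventually_le)
      show "\<forall>\<^sub>F u in ?F. u \<in> range ereal" by (rule dom[OF a])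
      fix u :: ereal assume u: "u \<in> range ereal"
      show "\<forall>\<^sub>F v in ?F. ereal (g (real_of_ereal u)) \<le> ereal (g (real_of_ereal v))"
        using ev[OF u] dom[OF a]
      proof eventually_elim
        case (elim v)
        then have "before (real_of_ereal u) (real_of_ereal v)"
          using u by (cases u; cases v) (auto simp: before_def split: if_splits)
        from that[OF this] show ?case by simp
      qed
    qed
    have "(\<forall>r s. before r s \<longrightarrow> g r \<le> g s) \<or> (\<forall>r s. before r s \<longrightarrow> - g r \<le> - g s)"
      using g by (auto simp: before_def mono_def antimono_def)
    then have "(\<exists>l. ((\<lambda>u. ereal (g (real_of_ereal u))) \<longlongrightarrow> l) ?F) \<or>
      (\<exists>l. ((\<lambda>u. ereal (- g (real_of_ereal u))) \<longlongrightarrow> l) ?F)"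
      using inc[of g] inc[of "\<lambda>r. - g r"] by blast
    then show ?thesis
    proof
      assume "\<exists>l. ((\<lambda>u. ereal (- g (real_of_ereal u))) \<longlongrightarrow> l) ?F"
      then obtain l where "((\<lambda>u. ereal (- g (real_of_ereal u))) \<longlongrightarrow> l) ?F" ..
      from tendsto_uminus_ereal[OF this] show ?thesis by auto
    qed
  qed
  have "mono \<sigma> \<or> antimono \<sigma>"
    using \<open>inj \<sigma>\<close> injective_eq_monotone_map[OF is_interval_univ cont]
    using strict_mono_iff_mono[of UNIV \<sigma>] strict_antimono_iff_antimono[of UNIV \<sigma>] by blast
  then obtain l where l: "a \<notin> range ereal \<Longrightarrow> ((\<lambda>u. ereal (?\<sigma> u)) \<longlongrightarrow> l) ?F"
    using mono by blast
  have "continuous ?F ?\<sigma>" if "a \<in> range ereal"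
  proof -
    from that obtain r where r: "a = ereal r" by blast
    have "isCont \<sigma> r" using cont by (simp add: continuous_on_eq_continuous_at)
    from isCont_tendsto_compose[OF this lim_real_of_ereal[OF tendsto_ident_at]]
    show ?thesis by (simp add: r continuous_within)
  qed
  then have "((\<lambda>u. ereal (?\<sigma> u)) \<longlongrightarrow> ext_real \<sigma> a) (inf (nhds a) (principal (range ereal)))"
    unfolding ext_real_def using l by (rule tendsto_cont_ext)
  moreover have "filterlim (\<lambda>t. ereal (f t)) (inf (nhds a) (principal (range ereal))) F"
    using lim by (simp add: filterlim_inf filterlim_principal)
  ultimately show ?thesis
    by (auto dest: filterlim_compose)
qed

lemma cont_ext_limit_along:
  fixes x :: "real"
  assumes "continuous_on D f" and "x \<in> D \<or> has_finite_cont_ext D f"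
    and "(g \<longlongrightarrow> x) F" "F \<noteq> bot" and D: "\<And>t. g t \<in> D"
  shows "\<exists>l. ((\<lambda>t. f (g t)) \<longlongrightarrow> l) F"
  using assms(2)
proof
  assume "x \<in> D"
  with continuous_on_tendsto_compose[OF assms(1,3)] D show ?thesis by auto
next
  assume "has_finite_cont_ext D f"
  then obtain f' where f': "continuous_on (closure D) f'" "\<And>x. x \<in> D \<Longrightarrow> f' x = f x"
    unfolding has_finite_cont_ext_def by blast
  have cl: "g t \<in> closure D" for t using D closure_subset by blast
  then have "x \<in> closure D"
    by (intro Lim_in_closed_set[OF closed_closure _ assms(4,3)]) simp
  with continuous_on_tendsto_compose[OF f'(1) assms(3)] cl
  have "((\<lambda>t. f' (g t)) \<longlongrightarrow> f' x) F" by simp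
  then show ?thesis using f'(2) D by auto
qed

section \<open>Convexity of the antiderivative up to the boundary\<close>

text \<open>
  Convexity of \<open>H\<close> in the form needed here: integrate \<open>h \<ge> h q\<close> to the right of \<open>q\<close> and \<open>h \<le> h q\<close> to
  the left of it.
\<close>

lemma supporting_line:
  assumes H: "continuous_antiderivative_on D h H" and mono: "mono_on D h"
    and D: "is_interval D" and pq: "p \<in> D" "q \<in> D"
  shows "H q + h q * (p - q) \<le> H p"
proof (cases "q \<le> p")
  case True
  have sub: "{q..p} \<subseteq> D"
    using mem_is_interval_1_I[OF D pq(2,1)] by auto
  have "((\<lambda>_. h q) has_integral (p - q) *\<^sub>R h q) {q..p}"
    using has_integral_const_real[of "h q" q p] True by simp
  moreover have "(h has_integral (H p - H q)) {q..p}"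
    using H True pq by (auto simp: continuous_antiderivative_on_def)
  ultimately have "(p - q) *\<^sub>R h q \<le> H p - H q"
    by (rule has_integral_le) (use sub pq in \<open>auto intro!: mono_onD[OF mono]\<close>)
  then show ?thesis by (simp add: algebra_simps)
next
  case False
  have sub: "{p..q} \<subseteq> D"
    using mem_is_interval_1_I[OF D pq] by auto
  have const: "((\<lambda>_. h q) has_integral (q - p) *\<^sub>R h q) {p..q}"
    using has_integral_const_real[of "h q" p q] False by simp
  have int: "(h has_integral (H q - H p)) {p..q}"
    using H False pq by (auto simp: continuous_antiderivative_on_def)
  have "H q - H p \<le> (q - p) *\<^sub>R h q"
    by (rule has_integral_le[OF int const]) (use sub pq in \<open>auto intro!: mono_onD[OF mono]\<close>)
  then show ?thesis by (simp add: algebra_simps)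
qed

text \<open>
  Since \<open>x\<close> lies outside the interval \<open>D\<close>, all of \<open>D\<close> is on one side of it. For any \<open>q\<close> in \<open>D\<close>,
  subtracting the linear function of slope \<open>h q\<close> turns \<open>H\<close> into a function \<open>K\<close> that is nondecreasing
  in the direction from \<open>q\<close> towards \<open>x\<close>, so that \<open>K\<close> converges to its supremum there. Adding the
  linear function back preserves convergence.
\<close>

lemma boundary_limit:
  assumes H: "continuous_antiderivative_on D h H" and mono: "mono_on D h"
    and D: "is_interval D" and x: "x \<notin> D"
  shows "\<exists>l. ((\<lambda>u. ereal (H u)) \<longlongrightarrow> l) (at x within D)"
proof (cases "D = {}")
  case False
  then obtain q where q: "q \<in> D" by blast
  have "x \<noteq> q" using q x by blast
  define S where "S = {u \<in> D. if q < x then q \<le> u else u \<le> q}"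
  define K where "K u = H u - h q * u" for u
  have inD: "\<forall>\<^sub>F u in at x within D. u \<in> D"
    by (auto simp: eventually_at_topological)
  have side: "if q < x then u < x else x < u" if "u \<in> D" for u
    using that x q D \<open>x \<noteq> q\<close> unfolding is_interval_1 by (smt (verit))
  have beyond: "\<forall>\<^sub>F v in at x within D. if q < x then u < v else v < u" if "u \<in> D" for u
    using side[OF that] by (cases "q < x") (auto intro: order_tendstoD[OF tendsto_ident_at])
  have "((\<lambda>u. ereal (K u)) \<longlongrightarrow> (SUP u\<in>S. ereal (K u))) (at x within D)"
  proof (rule tendsto_SUP_of_eventually_le)
    show "\<forall>\<^sub>F v in at x within D. v \<in> S"
      using inD beyond[OF q] by eventually_elim (auto simp: S_def split: if_splits)
  next
    fix u assume u: "u \<in> S"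
    then have "u \<in> D" by (simp add: S_def)
    show "\<forall>\<^sub>F v in at x within D. ereal (K u) \<le> ereal (K v)"
      using inD beyond[OF \<open>u \<in> D\<close>]
    proof eventually_elim
      case (elim v)
      have "0 \<le> (h u - h q) * (v - u)"
        using elim u q \<open>u \<in> D\<close> mono_onD[OF mono, of q u] mono_onD[OF mono, of u q]
        by (auto simp: S_def split: if_splits intro: mult_nonneg_nonneg mult_nonpos_nonpos)
      also have "\<dots> \<le> K v - K u"
        using supporting_line[OF H mono D elim(1) \<open>u \<in> D\<close>] by (simp add: K_def algebra_simps)
      finally show ?case by simp
    qed
  qed
  moreover have "((\<lambda>u. ereal (h q * u)) \<longlongrightarrow> ereal (h q * x)) (at x within D)"
    by (intro tendsto_intros)
  ultimately have "((\<lambda>u. ereal (K u) + ereal (h q * u)) \<longlongrightarrow>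
      (SUP u\<in>S. ereal (K u)) + ereal (h q * x)) (at x within D)"
    by (intro tendsto_add_ereal_general) simp_all
  then show ?thesis by (auto simp: K_def)
qed simp

lemma extended_antiderivative_tendsto:
  assumes H: "continuous_antiderivative_on D h H" and "mono_on D h" "is_interval D"
  shows "((\<lambda>u. ereal (H u)) \<longlongrightarrow> cont_ext D H x) (inf (nhds x) (principal D))"
proof -
  obtain l where "x \<notin> D \<Longrightarrow> ((\<lambda>u. ereal (H u)) \<longlongrightarrow> l) (at x within D)"
    using boundary_limit[OF assms, of x] by blast
  moreover have "x \<in> D \<Longrightarrow> continuous (at x within D) H"
    using H by (simp add: continuous_antiderivative_on_def continuous_on_eq_continuous_within)
  ultimately show ?thesis
    by (intro tendsto_cont_ext)
qed

lemma extended_supporting_line: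
  assumes H: "continuous_antiderivative_on D h H" and "mono_on D h" "is_interval D"
    and x: "x \<in> closure D" and q: "q \<in> D"
  shows "ereal (H q + h q * (x - q)) \<le> cont_ext D H x"
proof (rule tendsto_le[OF nhds_inf_principal_neq_bot[OF x]
      extended_antiderivative_tendsto[OF assms(1-3)]])
  have "((\<lambda>u. u) \<longlongrightarrow> x) (inf (nhds x) (principal D))"
    by (rule filterlim_inf[THEN iffD1, THEN conjunct1, OF filterlim_ident])
  then show "((\<lambda>u. ereal (H q + h q * (u - q))) \<longlongrightarrow> ereal (H q + h q * (x - q)))
      (inf (nhds x) (principal D))"
    by (intro tendsto_intros)
  show "\<forall>\<^sub>F u in inf (nhds x) (principal D). ereal (H q + h q * (u - q)) \<le> ereal (H u)"
    using supporting_line[OF assms(1-3) _ q]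
    by (auto simp: eventually_inf_principal)
qed

section \<open>The objective and the Bregman divergence\<close>

lemma closure_cart_power_component:
  assumes "p \<in> closure (cart_power D)"
  shows "p $ i \<in> closure D"
proof -
  have "(\<lambda>p. p $ i) ` closure (cart_power D) \<subseteq> closure ((\<lambda>p. p $ i) ` cart_power D)"
    by (rule continuous_image_closure_subset[where A = UNIV]) (auto intro!: continuous_intros)
  also have "\<dots> \<subseteq> closure D"
    by (rule closure_mono) (auto simp: cart_power_def)
  finally show ?thesis using assms by blast
qed

lemma tendsto_sum_ereal_not_MInfty:
  fixes f :: "'i \<Rightarrow> 'a \<Rightarrow> ereal"
  assumes "finite I" and "\<And>i. i \<in> I \<Longrightarrow> (f i \<longlongrightarrow> l i) F" and "\<And>i. i \<in> I \<Longrightarrow> l i \<noteq> -\<infinity>"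
  shows "((\<lambda>x. \<Sum>i\<in>I. f i x) \<longlongrightarrow> (\<Sum>i\<in>I. l i)) F"
proof -
  have "((\<lambda>x. \<Sum>i\<in>I. f i x) \<longlongrightarrow> (\<Sum>i\<in>I. l i)) F \<and> (\<Sum>i\<in>I. l i) \<noteq> -\<infinity>"
    using assms
  proof (induction I rule: finite_induct)
    case (insert i I)
    then have "(f i \<longlongrightarrow> l i) F" "l i \<noteq> -\<infinity>" "(\<Sum>j\<in>I. l j) \<noteq> -\<infinity>"
      "((\<lambda>x. \<Sum>i\<in>I. f i x) \<longlongrightarrow> (\<Sum>i\<in>I. l i)) F" by auto
    with insert(1,2) show ?case
      using tendsto_add_ereal_general[of "l i" "\<Sum>j\<in>I. l j" "f i" F "\<lambda>x. \<Sum>j\<in>I. f j x"]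
      by (cases "l i"; cases "\<Sum>j\<in>I. l j") auto
  qed simp
  then show ?thesis ..
qed

text \<open>
  The objective is defined by extending the summands one by one. This identifies it with the extension
  of the whole sum, which is the form in which the Bregman divergence is extended.
\<close>

lemma objective_tendsto:
  fixes p v :: "real ^ 'n"
  assumes "continuous_antiderivative_on D h H" "mono_on D h" "is_interval D"
    and p: "p \<in> closure (cart_power D)"
  shows "((\<lambda>u. ereal (separable_sum H u - (\<Sum>i\<in>UNIV. u $ i * h (v $ i)))) \<longlongrightarrow> objective D h H v p)
    (inf (nhds p) (principal (cart_power D)))"
proof -
  let ?F = "inf (nhds p) (principal (cart_power D))"
  have id: "((\<lambda>u. u) \<longlongrightarrow> p) ?F"
    by (rule filterlim_inf[THEN iffD1, THEN conjunct1, OF filterlim_ident])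
  have "((\<lambda>u. ereal (H (u $ i)) - ereal (u $ i * h (v $ i))) \<longlongrightarrow>
      cont_ext D H (p $ i) - ereal (p $ i * h (v $ i))) ?F" for i
  proof -
    have "filterlim (\<lambda>u. u $ i) (inf (nhds (p $ i)) (principal D)) ?F"
      using tendsto_vec_nth[OF id, of i]
      by (auto simp: filterlim_inf filterlim_principal eventually_inf_principal cart_power_def)
    from filterlim_compose[OF extended_antiderivative_tendsto[OF assms(1-3)] this]
    have "((\<lambda>u. ereal (H (u $ i))) \<longlongrightarrow> cont_ext D H (p $ i)) ?F" .
    moreover have "((\<lambda>u. ereal (- (u $ i * h (v $ i)))) \<longlongrightarrow> ereal (- (p $ i * h (v $ i)))) ?F"
      by (intro tendsto_intros tendsto_vec_nth id)
    ultimately show ?thesis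
      unfolding minus_ereal_def uminus_ereal.simps
      by (intro tendsto_add_ereal_general) simp_all
  qed
  moreover have "cont_ext D H (p $ i) - ereal (p $ i * h (v $ i)) \<noteq> -\<infinity>" for i
  proof -
    from p have "cart_power D \<noteq> ({} :: (real ^ 'n) set)" by auto
    then obtain q where "q \<in> D" by (auto simp: cart_power_def)
    from extended_supporting_line[OF assms(1-3) closure_cart_power_component[OF p] this, of i]
    show ?thesis by (cases "cont_ext D H (p $ i)") auto
  qed
  ultimately have "((\<lambda>u. \<Sum>i\<in>UNIV. ereal (H (u $ i)) - ereal (u $ i * h (v $ i))) \<longlongrightarrow>
      objective D h H v p) ?F"
    unfolding objective_def
    by (intro tendsto_sum_ereal_not_MInfty) auto
  then show ?thesis
    by (simp add: separable_sum_def sum_subtractf)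
qed

lemma bregman_ext_eq_objective:
  fixes p v :: "real ^ 'n"
  assumes H: "continuous_antiderivative_on D h H" "mono_on D h" "is_interval D"
    and "open D" "continuous_on D h"
    and p: "p \<in> closure (cart_power D)" and v: "v \<in> cart_power D"
  shows "cont_ext (cart_power D) (\<lambda>p. bregman_div (separable_sum H) p v) p =
    objective D h H v p + ereal ((\<Sum>i\<in>UNIV. v $ i * h (v $ i)) - separable_sum H v)"
proof (rule cont_ext_eqI[OF p])
  have "gradient (separable_sum H) v = entrywise h v"
    using v assms(4,5) H(1)
    by (intro gradient_separable_sum antiderivative_has_derivative)
      (auto simp: cart_power_def continuous_on_eq_continuous_at)
  then have "bregman_div (separable_sum H) u v =
      (separable_sum H u - (\<Sum>i\<in>UNIV. u $ i * h (v $ i))) +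
      ((\<Sum>i\<in>UNIV. v $ i * h (v $ i)) - separable_sum H v)" for u
    by (simp add: bregman_div_def inner_vec_def entrywise_def algebra_simps sum_subtractf)
  then have eq: "ereal (bregman_div (separable_sum H) u v) =
      ereal (separable_sum H u - (\<Sum>i\<in>UNIV. u $ i * h (v $ i))) +
      ereal ((\<Sum>i\<in>UNIV. v $ i * h (v $ i)) - separable_sum H v)" for u
    by simp
  show "((\<lambda>u. ereal (bregman_div (separable_sum H) u v)) \<longlongrightarrow> objective D h H v p +
      ereal ((\<Sum>i\<in>UNIV. v $ i * h (v $ i)) - separable_sum H v))
    (inf (nhds p) (principal (cart_power D)))"
    unfolding eq
    by (intro tendsto_add_ereal_general objective_tendsto[OF H p] tendsto_const) simp
qed

section \<open>Minimality of the limit\<close>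

lemma at_left_time:
  assumes "0 < T"
  shows "at_left T \<noteq> bot" and "\<forall>\<^sub>F t in at_left T. real_of_ereal t \<in> time_interval T"
proof -
  show "at_left T \<noteq> bot"
  proof
    assume "at_left T = bot"
    then have "eventually (\<lambda>_. False) (at_left T)" by simp
    then obtain b where "b < T" "\<And>t. b < t \<Longrightarrow> \<not> t < T"
      using eventually_at_left[OF assms, of "\<lambda>_. False"] by auto
    then show False using dense[of b T] by blast
  qed
  show "\<forall>\<^sub>F t in at_left T. real_of_ereal t \<in> time_interval T"
    unfolding eventually_at_left[OF assms]
  proof (intro exI[of _ 0] conjI allI impI assms)
    fix t assume "0 < t" "t < T"
    then show "real_of_ereal t \<in> time_interval T"
      by (cases t) (auto simp: time_interval_def)
  qed
qed

theorem theorem2p4: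
  fixes A :: "real ^ 'n ^ 'm" and y :: "real ^ 'm"
    and \<sigma>rp \<sigma>link :: "real \<Rightarrow> real"
    and L :: "(real ^ 'm) \<times> (real ^ 'm) \<Rightarrow> real"
    and D :: "real set" and T :: ereal
    and w :: "real \<Rightarrow> real ^ 'n" and w0 :: "real ^ 'n"
    and h H :: "real \<Rightarrow> real"
    and wT :: "ereal ^ 'n" and wtT :: "real ^ 'n"
  defines "wt0 \<equiv> entrywise \<sigma>rp w0"
    and "feasible \<equiv> {z \<in> closure (cart_power D). reduced_loss L \<sigma>link A y z = 0}"
  assumes A1: "\<sigma>link C1_differentiable_on UNIV" "inj \<sigma>link" "y \<in> range (entrywise \<sigma>link)"
    and A2: "is_interval D" "bij_betw \<sigma>rp UNIV D" "\<sigma>rp C1_differentiable_on UNIV"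
      "AE x in lebesgue. deriv \<sigma>rp x \<noteq> 0"
      "AE z in lebesgue. z \<in> D \<longrightarrow> inv \<sigma>rp differentiable (at z)"
      "locally_L1_on (inv_deriv_sq \<sigma>rp) D"
    and A3: "continuously_differentiable L" "\<And>z'. convex_on UNIV (\<lambda>z. L (z, z'))"
      "\<And>z z'. 0 \<le> L (z, z')" "\<And>z z'. L (z, z') = 0 \<longleftrightarrow> z = z'"
    and A4: "\<exists>z0 \<in> cart_power D. entrywise \<sigma>link (A *v z0) = y"
    and T: "0 < T"
    and flow: "gradient_flow (param_loss L \<sigma>link \<sigma>rp A y) T w0 w"
    and regular: "regular_curve \<sigma>rp T w"
    and h: "continuous_antiderivative_on D (inv_deriv_sq \<sigma>rp) h"
    and H: "continuous_antiderivative_on D h H"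
    and limit: "((\<lambda>t. entrywise ereal (w (real_of_ereal t))) \<longlongrightarrow> wT) (at_left T)"
    and wtT: "entrywise ereal wtT = entrywise (ext_real \<sigma>rp) wT"
    and zero_loss: "reduced_loss L \<sigma>link A y wtT = 0"
    and cond: "wtT \<in> cart_power D \<or> (has_finite_cont_ext D h \<and> has_finite_cont_ext D H)"
  shows "is_arg_min (objective D h H wt0) (\<lambda>z. z \<in> feasible) wtT \<and>
    {z. is_arg_min (objective D h H wt0) (\<lambda>z. z \<in> feasible) z} =
    {z. is_arg_min (cont_ext (cart_power D) (\<lambda>p. bregman_div (separable_sum H) p wt0))
          (\<lambda>z. z \<in> feasible) z}"
proof -
  have inj: "inj \<sigma>rp" and ran: "range \<sigma>rp = D"
    using A2(2) by (auto simp: bij_betw_def)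
  note cont\<sigma> = C1_has_real_derivative(3)[OF A2(3)]
  have "open D"
    using injective_eq_1d_open_map_UNIV[OF cont\<sigma> is_interval_univ] inj ran by auto
  have conth: "continuous_on D h" and contH: "continuous_on D H"
    using h H by (simp_all add: continuous_antiderivative_on_def)
  have mono: "mono_on D h"
  proof (rule mono_onI)
    fix r s assume "r \<in> D" "s \<in> D" "r \<le> s"
    then have "(inv_deriv_sq \<sigma>rp has_integral (h s - h r)) {r..s}"
      using h by (simp add: continuous_antiderivative_on_def)
    then have "0 \<le> h s - h r"
      by (rule has_integral_nonneg) (simp add: inv_deriv_sq_def)
    then show "h r \<le> h s" by simp
  qed
  note convexH = H mono A2(1)

  define W where "W t = entrywise \<sigma>rp (w (real_of_ereal t))" for t
  have WD: "W t $ i \<in> D" for t i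
    using ran by (auto simp: W_def entrywise_def)
  have wt0D: "wt0 \<in> cart_power D"
    using ran by (auto simp: wt0_def entrywise_def cart_power_def)
  note F = at_left_time[OF T]
  have Wlim: "((\<lambda>t. W t $ i) \<longlongrightarrow> wtT $ i) (at_left T)" for i
  proof -
    have "((\<lambda>t. ereal (w (real_of_ereal t) $ i)) \<longlongrightarrow> wT $ i) (at_left T)"
      using tendsto_vec_nth[OF limit, of i] by (simp add: entrywise_def)
    from ext_real_tendsto[OF cont\<sigma> inj this]
    have "((\<lambda>t. ereal (W t $ i)) \<longlongrightarrow> ext_real \<sigma>rp (wT $ i)) (at_left T)"
      by (simp add: W_def entrywise_def)
    moreover have "ext_real \<sigma>rp (wT $ i) = ereal (wtT $ i)"
      using wtT by (simp add: entrywise_def vec_eq_iff)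
    ultimately show ?thesis by simp
  qed
  have "wtT \<in> closure (cart_power D)"
  proof (rule Lim_in_closed_set[OF closed_closure _ F(1)])
    show "(W \<longlongrightarrow> wtT) (at_left T)" by (rule vec_tendstoI) (rule Wlim)
    show "\<forall>\<^sub>F t in at_left T. W t \<in> closure (cart_power D)"
      using WD by (intro always_eventually allI closure_subset[THEN subsetD]) (simp add: cart_power_def)
  qed
  with zero_loss have feasT: "wtT \<in> feasible" by (simp add: feasible_def)

  \<comment> \<open>Each alternative of \<open>cond\<close> yields finite limits of \<open>h\<close> and \<open>H\<close> along the trajectory: by
    continuity inside \<open>D\<close>, or by continuity of the finite extensions.\<close>
  have "\<exists>a. ((\<lambda>t. h (W t $ i)) \<longlongrightarrow> a) (at_left T)" for i
    using cond by (intro cont_ext_limit_along[OF conth _ Wlim F(1) WD]) (auto simp: cart_power_def)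
  then obtain a where a: "\<And>i. ((\<lambda>t. h (W t $ i)) \<longlongrightarrow> a i) (at_left T)" by metis
  have "\<exists>b. ((\<lambda>t. H (W t $ i)) \<longlongrightarrow> b) (at_left T)" for i
    using cond by (intro cont_ext_limit_along[OF contH _ Wlim F(1) WD]) (auto simp: cart_power_def)
  then obtain b where b: "\<And>i. ((\<lambda>t. H (W t $ i)) \<longlongrightarrow> b i) (at_left T)" by metis
  have extH: "cont_ext D H (wtT $ i) = ereal (b i)" for i
  proof (rule tendsto_unique[OF F(1)])
    show "((\<lambda>t. ereal (H (W t $ i))) \<longlongrightarrow> ereal (b i)) (at_left T)"
      using b by (rule tendsto_ereal)
    have "filterlim (\<lambda>t. W t $ i) (inf (nhds (wtT $ i)) (principal D)) (at_left T)"
      using Wlim[of i] WD by (simp add: filterlim_inf filterlim_principal)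
    from filterlim_compose[OF extended_antiderivative_tendsto[OF convexH] this]
    show "((\<lambda>t. ereal (H (W t $ i))) \<longlongrightarrow> cont_ext D H (wtT $ i)) (at_left T)" .
  qed

  have minimal: "objective D h H wt0 wtT \<le> objective D h H wt0 u" if u: "u \<in> feasible" for u
  proof -
    have "entrywise \<sigma>link (A *v u) = y" "entrywise \<sigma>link (A *v wtT) = y"
      using u feasT A3(4) by (auto simp: feasible_def reduced_loss_def)
    then have "A *v u = A *v wtT"
      by (simp add: entrywise_def vec_eq_iff) (metis injD[OF A1(2)])
    then have null: "A *v (u - wtT) = 0"
      by (simp add: matrix_vector_mult_diff_distrib)
    \<comment> \<open>The conservation law allows \<open>u\<close> to be replaced by \<open>wtT\<close> in the lower bound that the
      supporting lines at \<open>W t\<close> give for the objective at \<open>u\<close>; the result is \<open>\<psi> t\<close>.\<close>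
    define \<psi> where "\<psi> t = (\<Sum>i\<in>UNIV. H (W t $ i) + h (W t $ i) * (wtT $ i - W t $ i)
      - wtT $ i * h (wt0 $ i))" for t
    have "\<forall>\<^sub>F t in at_left T. ereal (\<psi> t) \<le> objective D h H wt0 u"
      using F(2)
    proof eventually_elim
      case (elim t)
      have "(\<Sum>i\<in>UNIV. (u - wtT) $ i * h (W t $ i)) = (\<Sum>i\<in>UNIV. (u - wtT) $ i * h (wt0 $ i))"
        using mirror_flow_conserved[OF A1(1) A3(1) A2(3,2) \<open>open D\<close> flow regular h null elim]
        by (simp add: W_def wt0_def entrywise_def)
      then have "\<psi> t = (\<Sum>i\<in>UNIV. H (W t $ i) + h (W t $ i) * (u $ i - W t $ i) - u $ i * h (wt0 $ i))"
        by (simp add: \<psi>_def algebra_simps sum.distrib sum_subtractf)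
      then have "ereal (\<psi> t) = (\<Sum>i\<in>UNIV. ereal (H (W t $ i) + h (W t $ i) * (u $ i - W t $ i))
          - ereal (u $ i * h (wt0 $ i)))"
        by simp
      also have "\<dots> \<le> objective D h H wt0 u"
        unfolding objective_def using u WD
        by (intro sum_mono ereal_minus_mono extended_supporting_line[OF convexH]
            closure_cart_power_component) (auto simp: feasible_def)
      finally show ?case .
    qed
    moreover have "((\<lambda>t. ereal (\<psi> t)) \<longlongrightarrow> ereal (\<Sum>i\<in>UNIV. b i + a i * (wtT $ i - wtT $ i)
        - wtT $ i * h (wt0 $ i))) (at_left T)"
      unfolding \<psi>_def by (intro tendsto_intros a b Wlim)
    ultimately have "ereal (\<Sum>i\<in>UNIV. b i + a i * (wtT $ i - wtT $ i) - wtT $ i * h (wt0 $ i))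
        \<le> objective D h H wt0 u"
      by (intro tendsto_upperbound[OF _ _ F(1)])
    then show ?thesis
      by (simp add: objective_def extH)
  qed

  define c where "c = (\<Sum>i\<in>UNIV. wt0 $ i * h (wt0 $ i)) - separable_sum H wt0"
  have breg: "cont_ext (cart_power D) (\<lambda>p. bregman_div (separable_sum H) p wt0) z =
      objective D h H wt0 z + ereal c" if "z \<in> feasible" for z
    using that bregman_ext_eq_objective[OF convexH \<open>open D\<close> conth _ wt0D]
    by (simp add: feasible_def c_def)
  have shift: "p + ereal c < q + ereal c \<longleftrightarrow> p < q" for p q
    by (cases p; cases q) auto
  have "is_arg_min (objective D h H wt0) (\<lambda>z. z \<in> feasible) wtT"
    using feasT minimal by (auto simp: is_arg_min_def not_less)
  moreover have "is_arg_min (objective D h H wt0) (\<lambda>z. z \<in> feasible) z \<longleftrightarrow>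
      is_arg_min (cont_ext (cart_power D) (\<lambda>p. bregman_div (separable_sum H) p wt0))
        (\<lambda>z. z \<in> feasible) z" for z
    by (auto simp: is_arg_min_def breg shift)
  ultimately show ?thesis by simp
qed

end
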